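(* Let $n\geqslant 2$ and let $E\subset\mathbb{R}^n$ be an open weakly $1$-convex set whose $1$-nonconvexity-point set $E^{\triangle}$ is non-empty. Then $E^{\triangle}$ is an open subset of $\mathbb{R}^n$.
   Context: $\mathbb{R}^n$ carries the Euclidean norm. An open set $E\subset\mathbb{R}^n$ is called weakly $1$-convex if for every point $x\in\partial E$ there exists a straight line $L$ (a $1$-dimensional affine subspace) with $x\in L$ and $L\cap E=\varnothing$. A point $x\in\mathbb{R}^n\setminus E$ is a $1$-nonconvexity point of $E\subset\mathbb{R}^n$ if every straight line passing through $x$ intersects $E$. $E^{\triangle}$ denotes the set of all $1$-nonconvexity points of $E$. *)

theory Defs
  imports "HOL-Analysis.Analysis"
begin

definition straight_line :: "'a::euclidean_space set \<Rightarrow> bool" where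
  "straight_line L \<longleftrightarrow> affine L \<and> aff_dim L = 1"

(* Used for open sets only; openness of E is always a separate hypothesis. *)
definition weakly_1_convex :: "'a::euclidean_space set \<Rightarrow> bool" where
  "weakly_1_convex E \<longleftrightarrow>
     (\<forall>x \<in> frontier E. \<exists>L. straight_line L \<and> x \<in> L \<and> L \<inter> E = {})"

definition nonconvexity_point_1 :: "'a::euclidean_space set \<Rightarrow> 'a \<Rightarrow> bool" where
  "nonconvexity_point_1 E x \<longleftrightarrow>
     x \<notin> E \<and> (\<forall>L. straight_line L \<and> x \<in> L \<longrightarrow> L \<inter> E \<noteq> {})"

definition nonconvexity_set_1 :: "'a::euclidean_space set \<Rightarrow> 'a set" where
  "nonconvexity_set_1 E = {x. nonconvexity_point_1 E x}"

end

theory Submission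
  imports Defs
begin

text \<open>A nonconvexity point is off the frontier of E by weak convexity, hence off the closure.
  The set of pairs (y, u) for which the line through y in direction u meets E is open, and the
  unit directions form a compact set, so the points all of whose lines meet E form an open set.\<close>

lemma straight_line_range:
  fixes x u :: "'a::euclidean_space"
  assumes "u \<noteq> 0"
  shows "straight_line (range (\<lambda>t. x + t *\<^sub>R u))"
proof -
  \<comment> \<open>As the hull of two distinct points, the range is affine and its dimension is
    that of the pair.\<close>
  have "range (\<lambda>t. x + t *\<^sub>R u) = affine hull {x, x + u}"
    by (simp add: affine_hull_2_alt)
  moreover have "aff_dim {x, x + u} = 1"
    using assms by (simp add: aff_dim_2)
  ultimately show ?thesis
    by (simp add: straight_line_def)
qed

text \<open>Inclusion in \<open>L\<close> suffices later: a point of \<open>E\<close> on the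
  parametrised line also lies on \<open>L\<close>.\<close>

lemma straight_line_obtain_unit_direction:
  fixes L :: "'a::euclidean_space set"
  assumes "straight_line L" "x \<in> L"
  obtains u where "norm u = 1" "range (\<lambda>t. x + t *\<^sub>R u) \<subseteq> L"
proof -
  \<comment> \<open>A singleton has affine dimension 0, so \<open>L\<close> must contain a second
    point.\<close>
  have "L \<noteq> {x}" and aff: "affine L"
    using assms by (auto simp: straight_line_def)
  then obtain y where y: "y \<in> L" "y \<noteq> x"
    using assms by blast
  show thesis
  proof
    show "norm (sgn (y - x)) = 1"
      using y by (simp add: norm_sgn)
    show "range (\<lambda>t. x + t *\<^sub>R sgn (y - x)) \<subseteq> L"
    proof clarify
      fix t
      \<comment> \<open>The weight on \<open>y\<close> absorbs the normalising factor in
        \<open>sgn (y - x)\<close>.\<close>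
      have "(1 - t / norm (y - x)) *\<^sub>R x + (t / norm (y - x)) *\<^sub>R y \<in> L"
        using aff assms y by (simp add: mem_affine)
      then show "x + t *\<^sub>R sgn (y - x) \<in> L"
        by (simp add: sgn_div_norm algebra_simps divide_inverse)
    qed
  qed
qed

text \<open>Trades the quantifier over lines for one over the unit sphere, whose compactness can
  then be exploited.\<close>

lemma all_straight_lines_meet_iff:
  fixes x :: "'a::euclidean_space"
  shows "(\<forall>L. straight_line L \<and> x \<in> L \<longrightarrow> L \<inter> E \<noteq> {}) \<longleftrightarrow>
    (\<forall>u\<in>sphere 0 1. \<exists>t. x + t *\<^sub>R u \<in> E)"
proof (intro iffI ballI allI impI)
  fix u :: 'a
  assume "\<forall>L. straight_line L \<and> x \<in> L \<longrightarrow> L \<inter> E \<noteq> {}" and "u \<in> sphere 0 1"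
  moreover from this have "straight_line (range (\<lambda>t. x + t *\<^sub>R u))"
    by (intro straight_line_range) auto
  moreover have "x \<in> range (\<lambda>t. x + t *\<^sub>R u)"
    by (rule range_eqI[of _ _ 0]) simp
  ultimately show "\<exists>t. x + t *\<^sub>R u \<in> E"
    by blast
next
  fix L
  assume *: "\<forall>u\<in>sphere 0 1. \<exists>t. x + t *\<^sub>R u \<in> E" and "straight_line L \<and> x \<in> L"
  then obtain u where u: "norm u = 1" "range (\<lambda>t. x + t *\<^sub>R u) \<subseteq> L"
    by (auto elim: straight_line_obtain_unit_direction)
  from u(1) have "u \<in> sphere 0 1"
    by simp
  with * obtain t where "x + t *\<^sub>R u \<in> E"
    by blast
  with u show "L \<inter> E \<noteq> {}"
    by blast
qed

text \<open>Each direction has its own neighbourhood of \<open>x\<close>; compactness of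
  \<open>S\<close> yields one that serves all directions.\<close>

lemma open_all_directions_meet:
  fixes E :: "'a::real_normed_vector set"
  assumes "open E" "compact S"
  shows "open {x. \<forall>u\<in>S. \<exists>t. x + t *\<^sub>R u \<in> E}"
proof -
  \<comment> \<open>For fixed \<open>t\<close> the map is jointly continuous in \<open>x\<close> and
    \<open>u\<close>, so \<open>W\<close> is a union of open preimages.\<close>
  define W where "W = (\<Union>t. (\<lambda>(x, u). x + t *\<^sub>R u) -` E)"
  have "open W"
    unfolding W_def case_prod_unfold
    by (intro open_UN ballI open_vimage assms continuous_intros)
  have "\<exists>U. open U \<and> x \<in> U \<and> U \<subseteq> {x. \<forall>u\<in>S. \<exists>t. x + t *\<^sub>R u \<in> E}"
    if "\<forall>u\<in>S. \<exists>t. x + t *\<^sub>R u \<in> E" for x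
  proof -
    \<comment> \<open>The tube lemma thickens this slice to a product \<open>U \<times> S\<close>
      inside \<open>W\<close>.\<close>
    have "{x} \<times> S \<subseteq> W"
      using that by (auto simp: W_def)
    then obtain U where "open U" "x \<in> U" "U \<times> S \<subseteq> W"
      using Elementary_Topology.tube_lemma[OF assms(2) \<open>open W\<close>] by metis
    then show ?thesis
      by (intro exI[of _ U]) (auto simp: W_def)
  qed
  then show ?thesis
    by (subst open_subopen) blast
qed

text \<open>Lying outside an open \<open>E\<close> is in general not an open condition. Weak
  convexity upgrades it to lying outside the closure, because a frontier point has a line missing
  \<open>E\<close>.\<close>

lemma nonconvexity_set_1_eq:
  assumes "weakly_1_convex E"
  shows "nonconvexity_set_1 E =
    - closure E \<inter> {x. \<forall>u\<in>sphere 0 1. \<exists>t. x + t *\<^sub>R u \<in> E}"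
proof -
  have "x \<notin> closure E" if "nonconvexity_point_1 E x" for x
  proof
    assume "x \<in> closure E"
    with that have "x \<in> frontier E"
      using interior_subset by (auto simp: frontier_def nonconvexity_point_1_def)
    with assms that show False
      by (auto simp: weakly_1_convex_def nonconvexity_point_1_def)
  qed
  moreover have "nonconvexity_point_1 E x \<longleftrightarrow>
      x \<notin> E \<and> (\<forall>u\<in>sphere 0 1. \<exists>t. x + t *\<^sub>R u \<in> E)" for x
    unfolding nonconvexity_point_1_def all_straight_lines_meet_iff ..
  ultimately show ?thesis
    using closure_subset[of E] unfolding nonconvexity_set_1_def by blast
qed

theorem theorem2:
  fixes E :: "(real ^ 'n) set"
  assumes "CARD('n) \<ge> 2"
    and "open E"
    and "weakly_1_convex E"
    and "nonconvexity_set_1 E \<noteq> {}"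
  shows "open (nonconvexity_set_1 E)"
  unfolding nonconvexity_set_1_eq[OF assms(3)]
  using assms(2) by (intro open_Int open_all_directions_meet) auto

end
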